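(* Let $r\in\mathbb{R}$, $\sigma\ge 0$, $T>0$, let $S(t)=e^{(r-\sigma^2/2)t+\sigma B(t)}$ for $t\ge 0$, where $B$ is a standard Brownian motion, and let $A(T)=\frac1T\int_0^T S(t)\,dt$. Let $$b_k:=kr+\frac{\sigma^2 k(k-1)}{2},\qquad k=0,1,\dots.$$ Then, for every integer $m\ge 0$, $$\mathbb{E}\left(A(T)^m\right)=m!\,\exp[b_0T,\,b_1T,\,\dots,\,b_mT].$$
   Context: $B:[0,\infty)\to\mathbb{R}$ is standard Brownian motion: $B(0)=0$, increments are independent, and for $0\le s<t$ the increment $B(t)-B(s)$ is normal with mean $0$ and variance $t-s$ (with continuous paths). For a function $f$ and points $a_0,\dots,a_n$, the divided difference $f[a_0,\dots,a_n]$ is the coefficient of $x^n$ in the unique polynomial of degree at most $n$ interpolating $f$ at $a_0,\dots,a_n$; it does not depend on the order of the points. If points coincide and $f$ is sufficiently differentiable, interpolation is understood in the Hermite sense (matching derivatives up to multiplicity minus one). $\exp[a_0,\dots,a_n]$ denotes the divided difference of the exponential function. *)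

theory Defs
  imports "HOL-Probability.Probability" "HOL-Computational_Algebra.Polynomial"
begin

locale standard_brownian_motion = prob_space M for M :: "'a measure" +
  fixes B :: "real \<Rightarrow> 'a \<Rightarrow> real"
  assumes random_variable_B: "\<And>t. t \<ge> 0 \<Longrightarrow> random_variable borel (B t)"
    and B_zero: "\<And>\<omega>. \<omega> \<in> space M \<Longrightarrow> B 0 \<omega> = 0"
    and indep_increments:
      "\<And>(t :: nat \<Rightarrow> real) n. 0 \<le> t 0 \<Longrightarrow> (\<And>i. i < n \<Longrightarrow> t i < t (Suc i)) \<Longrightarrow>
        indep_vars (\<lambda>_. borel) (\<lambda>i \<omega>. B (t (Suc i)) \<omega> - B (t i) \<omega>) {..<n}"
    and normal_increments:
      "\<And>s t. 0 \<le> s \<Longrightarrow> s < t \<Longrightarrow>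
        distributed M lborel (\<lambda>\<omega>. B t \<omega> - B s \<omega>) (normal_density 0 (sqrt (t - s)))"
    and continuous_paths: "\<And>\<omega>. \<omega> \<in> space M \<Longrightarrow> continuous_on {0..} (\<lambda>t. B t \<omega>)"

text \<open>A value occurring with multiplicity \<open>\<mu>\<close> among \<open>a 0, \<dots>, a n\<close> prescribes the
  derivatives of order \<open>0, \<dots>, \<mu> - 1\<close> there; for distinct points this is Lagrange interpolation.\<close>

definition hermite_interpolates ::
  "(real \<Rightarrow> real) \<Rightarrow> (nat \<Rightarrow> real) \<Rightarrow> nat \<Rightarrow> real poly \<Rightarrow> bool" where
  "hermite_interpolates f a n p \<longleftrightarrow>
     (\<forall>i\<le>n. \<forall>j < card {k. k \<le> n \<and> a k = a i}.
        poly ((pderiv ^^ j) p) (a i) = (deriv ^^ j) f (a i))"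

definition divided_difference :: "(real \<Rightarrow> real) \<Rightarrow> (nat \<Rightarrow> real) \<Rightarrow> nat \<Rightarrow> real" where
  "divided_difference f a n =
     coeff (THE p. degree p \<le> n \<and> hermite_interpolates f a n p) n"

definition stock_price ::
  "real \<Rightarrow> real \<Rightarrow> (real \<Rightarrow> 'a \<Rightarrow> real) \<Rightarrow> real \<Rightarrow> 'a \<Rightarrow> real" where
  "stock_price r \<sigma> B t \<omega> = exp ((r - \<sigma>\<^sup>2 / 2) * t + \<sigma> * B t \<omega>)"

definition time_average :: "(real \<Rightarrow> 'a \<Rightarrow> real) \<Rightarrow> real \<Rightarrow> 'a \<Rightarrow> real" where
  "time_average S T \<omega> = (1 / T) * (LBINT t:{0..T}. S t \<omega>)"

definition moment_rate :: "real \<Rightarrow> real \<Rightarrow> nat \<Rightarrow> real" where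
  "moment_rate r \<sigma> k = real k * r + \<sigma>\<^sup>2 * real k * (real k - 1) / 2"

end

theory Submission
  imports Defs
begin

text \<open>
  Write \<open>S\<close> for the price, \<open>b k\<close> for the moment rates, and \<open>g\<^sub>0 t = exp (b 0 * t)\<close>,
  \<open>g\<^sub>k t = \<integral>\<^sub>0\<^sup>t exp (b k * (t - s)) * g\<^bsub>k-1\<^esub> s ds\<close> for the iterated convolution of the exponentials
  \<open>exp (b k * t)\<close>.  The moment formula holds because both sides equal \<open>m! * g\<^sub>m T / T ^ m\<close>.

  Probabilistic side (\<open>expectation_price_integral_power\<close>).  The \<open>m\<close>-th power of \<open>\<integral>\<^sub>0\<^sup>T S\<close> is \<open>m!\<close> times the integral
  of \<open>S t\<^sub>1 \<cdots> S t\<^sub>m\<close> over \<open>0 < t\<^sub>1 < \<cdots> < t\<^sub>m < T\<close>.  As \<open>S 0 = 1\<close>, this product regroups as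
  \<open>(S t\<^sub>1 / S 0) ^ m * (S t\<^sub>2 / S t\<^sub>1) ^ (m - 1) \<cdots> (S t\<^sub>m / S t\<^sub>m\<^sub>-\<^sub>1)\<close>, whose factors are independent, and
  a \<open>k\<close>-th power of a ratio over a time \<open>d\<close> has expectation \<open>exp (b k * d)\<close>.  What remains is the
  convolution of \<open>exp (b m * t), \<dots>, exp (b 0 * t)\<close>, where \<open>b 0 = 0\<close> belongs to the time after \<open>t\<^sub>m\<close>.
  The ordering is carried out one variable at a time, by induction on the exponent
  (\<open>nn_integral_price_ratios_tail_integral_power\<close>).  All integrands are nonnegative, so
  Tonelli's theorem applies throughout and finiteness comes out at the end.

  Interpolation side (\<open>divided_difference_exp\<close>).  The functions \<open>g\<^sub>k\<close> solve \<open>g\<^sub>k' = b k * g\<^sub>k + g\<^bsub>k-1\<^esub>\<close>,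
  which makes \<open>\<Sum>k\<le>m. g\<^sub>k t * (\<Prod>i<k. x - b i)\<close> the Newton interpolation polynomial of
  \<open>x \<mapsto> exp (x * t)\<close>: the error is \<open>\<Prod>i\<le>m. x - b i\<close> times \<open>\<integral>\<^sub>0\<^sup>t exp (x * (t - s)) * g\<^sub>m s ds\<close>
  (\<open>newton_exp_remainder\<close>).  The second factor is smooth in \<open>x\<close>, so the
  error vanishes at each node to the order of its multiplicity.  Moment rates do coincide for certain
  parameters, and this covers that case as well.  Rescaling the nodes by \<open>t = T\<close> gives
  the powers of \<open>T\<close>.
\<close>

section \<open>Iterated convolution of exponentials\<close>

text \<open>Both sides of the moment formula reduce to the convolution of the exponentials
  \<open>exp (b 0 * t), \<dots>, exp (b m * t)\<close>.  It is the solution \<open>g\<^sub>m\<close> of the triangular linear system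
  \<open>g\<^sub>m' = b m * g\<^sub>m + g\<^bsub>m-1\<^esub>\<close> with \<open>g\<^sub>0 = exp (b 0 * t)\<close> and \<open>g\<^sub>m 0 = 0\<close> for \<open>m > 0\<close>; the recursion is
  variation of constants.  The oriented integral makes the system hold at every real \<open>t\<close>,
  also at and below \<open>0\<close>.\<close>

primrec iterated_exp_convolution :: "(nat \<Rightarrow> real) \<Rightarrow> nat \<Rightarrow> real \<Rightarrow> real" where
  "iterated_exp_convolution b 0 t = exp (b 0 * t)"
| "iterated_exp_convolution b (Suc m) t =
     exp (b (Suc m) * t) * (LBINT s=0..t. exp (- b (Suc m) * s) * iterated_exp_convolution b m s)"

lemma interval_integral_has_real_derivative:
  fixes f :: "real \<Rightarrow> real"
  assumes "\<And>x. isCont f x"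
  shows "((\<lambda>u. LBINT y=0..u. f y) has_real_derivative f x) (at x)"
proof -
  let ?a = "min 0 (x - 1)" and ?b = "max 0 (x + 1)"
  have "((\<lambda>u. LBINT y=ereal 0..u. f y) has_vector_derivative f x) (at x within {?a..?b})"
    by (rule interval_integral_FTC2) (auto intro: continuous_at_imp_continuous_on assms)
  moreover have "at x within {?a..?b} = at x"
    by (rule at_within_interior) (auto simp: interior_atLeastAtMost_real min_def max_def)
  ultimately show ?thesis
    by (simp add: has_real_derivative_iff_has_vector_derivative zero_ereal_def)
qed

lemma iterated_exp_convolution_isCont: "isCont (iterated_exp_convolution b m) t"
proof (induction m arbitrary: t)
  case 0
  have "iterated_exp_convolution b 0 = (\<lambda>t. exp (b 0 * t))" by (rule ext) simp
  then show ?case by (simp add: isCont_exp)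
next
  case (Suc m)
  have eq: "iterated_exp_convolution b (Suc m) =
    (\<lambda>t. exp (b (Suc m) * t) * (LBINT s=0..t. exp (- b (Suc m) * s) * iterated_exp_convolution b m s))"
    by (rule ext) simp
  have "isCont (\<lambda>t::real. LBINT s=0..t. exp (- b (Suc m) * s) * iterated_exp_convolution b m s) t"
    by (rule DERIV_isCont, rule interval_integral_has_real_derivative) (intro continuous_intros Suc)
  then show ?case unfolding eq by (intro continuous_intros)
qed

lemma iterated_exp_convolution_deriv_0:
  "(iterated_exp_convolution b 0 has_real_derivative b 0 * iterated_exp_convolution b 0 t) (at t)"
proof -
  have "iterated_exp_convolution b 0 = (\<lambda>t. exp (b 0 * t))" by (rule ext) simp
  then show ?thesis by (auto intro!: derivative_eq_intros)
qed

lemma iterated_exp_convolution_deriv_Suc: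
  "(iterated_exp_convolution b (Suc m) has_real_derivative
     b (Suc m) * iterated_exp_convolution b (Suc m) t + iterated_exp_convolution b m t) (at t)"
proof -
  have eq: "iterated_exp_convolution b (Suc m) =
    (\<lambda>t. exp (b (Suc m) * t) * (LBINT s=0..t. exp (- b (Suc m) * s) * iterated_exp_convolution b m s))"
    by (rule ext) simp
  have "((\<lambda>t. LBINT s=0..t. exp (- b (Suc m) * s) * iterated_exp_convolution b m s)
          has_real_derivative exp (- b (Suc m) * t) * iterated_exp_convolution b m t) (at t)"
    by (rule interval_integral_has_real_derivative)
       (intro continuous_intros iterated_exp_convolution_isCont)
  moreover have "((\<lambda>t. exp (b (Suc m) * t)) has_real_derivative b (Suc m) * exp (b (Suc m) * t)) (at t)"
    by (auto intro!: derivative_eq_intros)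
  moreover have "exp (- b (Suc m) * t) * exp (b (Suc m) * t) = 1"
    by (simp add: exp_add[symmetric])
  ultimately show ?thesis
    unfolding eq by - (rule DERIV_cong, erule (1) DERIV_mult[rotated], simp add: exp_minus)
qed

lemma iterated_exp_convolution_Suc_0 [simp]: "iterated_exp_convolution b (Suc m) 0 = 0"
  by (simp add: zero_ereal_def[symmetric])

lemma iterated_exp_convolution_nonneg: "t \<ge> 0 \<Longrightarrow> iterated_exp_convolution b m t \<ge> 0"
proof (induction m arbitrary: t)
  case (Suc m)
  have "0 \<le> (LBINT s:{0..t}. exp (- b (Suc m) * s) * iterated_exp_convolution b m s)"
    unfolding set_lebesgue_integral_def
    by (rule Bochner_Integration.integral_nonneg) (auto intro!: mult_nonneg_nonneg Suc.IH split: split_indicator)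
  then show ?case
    using Suc.prems by (simp add: interval_integral_Icc zero_ereal_def)
qed simp

declare iterated_exp_convolution.simps [simp del]

section \<open>Newton interpolation of the exponential with integral remainder\<close>

text \<open>The sum is Newton's interpolation polynomial \<open>q\<close> of \<open>x \<mapsto> exp (x * t)\<close> at the nodes \<open>b 0, \<dots>, b m\<close>,
  with a remainder that stays explicit when nodes coincide.  By the linear system, with
  \<open>b k = x - (x - b k)\<close>, the \<open>t\<close>-derivative of \<open>q\<close> telescopes to \<open>x * q\<close> minus
  \<open>g\<^sub>m t\<close> times the node product.  Hence \<open>exp (- x * t)\<close> times the right-hand side is constant in \<open>t\<close>,
  and it equals 1 at \<open>t = 0\<close>.\<close>

lemma newton_exp_remainder:
  "exp (x * t) = (\<Sum>k\<le>m. iterated_exp_convolution b k t * (\<Prod>i<k. x - b i))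
     + (\<Prod>i\<le>m. x - b i) * (exp (x * t) * (LBINT s=0..t. exp (- x * s) * iterated_exp_convolution b m s))"
proof -
  let ?g = "iterated_exp_convolution b"
  define q where "q t = (\<Sum>k\<le>m. ?g k t * (\<Prod>i<k. x - b i))" for t
  define I where "I t = (LBINT s=0..t. exp (- x * s) * ?g m s)" for t :: real
  have dq: "(q has_real_derivative x * q t - ?g m t * (\<Prod>i\<le>m. x - b i)) (at t)" for t
    unfolding q_def
  proof (induction m)
    case 0
    show ?case using iterated_exp_convolution_deriv_0[of b t] by (simp add: algebra_simps)
  next
    case (Suc m)
    show ?case unfolding sum.atMost_Suc
      by (rule DERIV_cong[OF DERIV_add[OF Suc DERIV_cmult_right[OF iterated_exp_convolution_deriv_Suc]]])
         (simp add: lessThan_Suc_atMost algebra_simps)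
  qed
  have dI: "(I has_real_derivative exp (- x * t) * ?g m t) (at t)" for t
    unfolding I_def by (rule interval_integral_has_real_derivative)
       (intro continuous_intros iterated_exp_convolution_isCont)
  define y where "y t = exp (- x * t) * q t + (\<Prod>i\<le>m. x - b i) * I t" for t
  have "DERIV y t :> 0" for t
    unfolding y_def
    by (rule DERIV_cong, (rule derivative_intros dq dI)+) (simp add: algebra_simps)
  then have "y t = y 0" by (rule DERIV_isconst_all[rule_format, rotated])
  moreover have "q 0 = 1"
    unfolding q_def by (induction m) (auto simp: iterated_exp_convolution.simps(1))
  ultimately have "exp (- x * t) * q t + (\<Prod>i\<le>m. x - b i) * I t = 1"
    by (simp add: y_def I_def zero_ereal_def[symmetric])
  then have "exp (x * t) = exp (x * t) * (exp (- x * t) * q t + (\<Prod>i\<le>m. x - b i) * I t)"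
    by simp
  also have "\<dots> = (exp (x * t) * exp (- x * t)) * q t + (\<Prod>i\<le>m. x - b i) * (exp (x * t) * I t)"
    by (simp add: algebra_simps)
  also have "exp (x * t) * exp (- x * t) = 1"
    by (simp add: exp_add[symmetric])
  finally show ?thesis
    by (simp add: q_def I_def)
qed

section \<open>Uniqueness of Hermite interpolation\<close>

lemma order_ge_if_derivatives_vanish:
  fixes p :: "real poly"
  assumes "p \<noteq> 0" "\<And>j. j < \<mu> \<Longrightarrow> poly ((pderiv ^^ j) p) a = 0"
  shows "\<mu> \<le> order a p"
  using assms
proof (induction \<mu> arbitrary: p)
  case (Suc \<mu>)
  have root: "poly p a = 0" using Suc.prems(2)[of 0] by simp
  have "pderiv p \<noteq> 0"
  proof
    assume "pderiv p = 0"
    then obtain c where "p = [:c:]" using pderiv_eq_0_iff degree_eq_zeroE by blast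
    with root Suc.prems(1) show False by simp
  qed
  moreover have "poly ((pderiv ^^ j) (pderiv p)) a = 0" if "j < \<mu>" for j
    using Suc.prems(2)[of "Suc j"] that by (simp add: funpow_swap1)
  ultimately have "\<mu> \<le> order a (pderiv p)" by (rule Suc.IH)
  moreover have "order a p = Suc (order a (pderiv p))"
    using order_pderiv[of p a] root \<open>p \<noteq> 0\<close> \<open>pderiv p \<noteq> 0\<close> by (simp add: order_root)
  ultimately show ?case by simp
qed simp

lemma higher_pderiv_diff:
  "(pderiv ^^ j) (p - q) = (pderiv ^^ j) p - (pderiv ^^ j) (q :: real poly)"
  by (induction j) (simp_all add: pderiv_diff)

text \<open>The difference of two interpolants has every node as a root of at least the prescribed
  multiplicity, so counted with multiplicity it has more roots than its degree allows.\<close>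

lemma hermite_interpolation_unique:
  assumes "degree p \<le> n" "hermite_interpolates f a n p"
    and "degree q \<le> n" "hermite_interpolates f a n q"
  shows "p = q"
proof (rule ccontr)
  assume "p \<noteq> q"
  define d where "d = p - q"
  have d: "d \<noteq> 0" "degree d \<le> n"
    using \<open>p \<noteq> q\<close> assms(1,3) by (auto simp: d_def intro: degree_diff_le)
  have ord: "card {k. k \<le> n \<and> a k = a i} \<le> order (a i) d" if "i \<le> n" for i
    using that assms(2,4) d(1)
    by (intro order_ge_if_derivatives_vanish)
       (auto simp: hermite_interpolates_def d_def higher_pderiv_diff)
  \<comment> \<open>multisets of nodes and of roots account for the multiplicities\<close>
  have "image_mset a (mset_set {..n}) \<subseteq># proots d"
  proof (rule mset_subset_eqI)
    fix x
    have "count (image_mset a (mset_set {..n})) x = card {k. k \<le> n \<and> a k = x}"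
      by (auto simp: count_image_mset vimage_def Int_def intro!: arg_cong[of _ _ card])
    moreover have "card {k. k \<le> n \<and> a k = x} \<le> order x d"
    proof (cases "\<exists>i\<le>n. a i = x")
      case False
      then have "{k. k \<le> n \<and> a k = x} = {}" by auto
      then show ?thesis by (simp only: card.empty)
    qed (use ord in auto)
    ultimately show "count (image_mset a (mset_set {..n})) x \<le> count (proots d) x"
      using d by simp
  qed
  from size_mset_mono[OF this] have "Suc n \<le> size (proots d)" by simp
  also have "\<dots> \<le> degree d" by (rule size_proots_le)
  finally show False using d by simp
qed

section \<open>Hermite interpolation of the exponential at possibly coinciding nodes\<close>

text \<open>Vanishing of \<open>f, f', \<dots>\<close> up to order \<open>\<mu> - 1\<close> at \<open>a\<close>, with the derivatives existing on the whole line.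
  The iterated operator \<^const>\<open>deriv\<close> is additive only where the derivatives exist, so existence is built in;
  additivity then goes through by recursion on the order.\<close>

primrec vanishes_to_order :: "nat \<Rightarrow> real \<Rightarrow> (real \<Rightarrow> real) \<Rightarrow> bool" where
  "vanishes_to_order 0 a f \<longleftrightarrow> True"
| "vanishes_to_order (Suc \<mu>) a f \<longleftrightarrow>
     f a = 0 \<and> (\<exists>f'. (\<forall>x. (f has_real_derivative f' x) (at x)) \<and> vanishes_to_order \<mu> a f')"

lemma vanishes_to_order_add:
  "vanishes_to_order \<mu> a f \<Longrightarrow> vanishes_to_order \<mu> a g \<Longrightarrow> vanishes_to_order \<mu> a (\<lambda>x. f x + g x)"
proof (induction \<mu> arbitrary: f g)
  case (Suc \<mu>)
  then obtain f' g' where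
    "\<forall>x. (f has_real_derivative f' x) (at x)" "vanishes_to_order \<mu> a f'"
    "\<forall>x. (g has_real_derivative g' x) (at x)" "vanishes_to_order \<mu> a g'" by auto
  then show ?case using Suc.prems Suc.IH[of f' g']
    by (auto intro!: exI[of _ "\<lambda>x. f' x + g' x"] derivative_intros)
qed simp

lemma vanishes_to_order_imp_higher_deriv_0:
  "vanishes_to_order \<mu> a f \<Longrightarrow> j < \<mu> \<Longrightarrow> (deriv ^^ j) f a = 0"
proof (induction \<mu> arbitrary: f j)
  case (Suc \<mu>)
  from Suc.prems obtain f' where f': "\<And>x. (f has_real_derivative f' x) (at x)" "vanishes_to_order \<mu> a f'"
    and "f a = 0" by auto
  have "deriv f = f'" using f'(1) by (auto intro: DERIV_imp_deriv)
  then show ?case using Suc.IH[OF f'(2)] Suc.prems(2) \<open>f a = 0\<close>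
    by (cases j) (auto simp: funpow_swap1)
qed simp

text \<open>Differentiating \<open>p * h k\<close> gives \<open>p' * h k + p * h (k + 1)\<close>: both summands have the same form, and both
  polynomials keep all but possibly one of the factors \<open>[:-a, 1:]\<close>.  Stating the lemma for a whole chain of successive
  derivatives \<open>h\<close> is what lets the induction close.\<close>

lemma vanishes_to_order_poly_mult:
  assumes h: "\<And>k x. (h k has_real_derivative h (Suc k) x) (at x)"
    and "[:-a, 1:] ^ \<mu> dvd p"
  shows "vanishes_to_order \<mu> a (\<lambda>x. poly p x * h k x)"
  using assms(2)
proof (induction \<mu> arbitrary: p k)
  case (Suc \<mu>)
  then obtain r where p: "p = [:-a, 1:] ^ Suc \<mu> * r" unfolding dvd_def by blast
  have dvd1: "[:-a, 1:] ^ \<mu> dvd p" unfolding p by (intro dvd_mult2 le_imp_power_dvd) simp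
  have dvd2: "[:-a, 1:] ^ \<mu> dvd pderiv p"
    unfolding p pderiv_mult pderiv_power_Suc
    by (rule dvd_add, rule dvd_mult2[OF le_imp_power_dvd], simp,
        rule dvd_mult, rule dvd_mult2, rule dvd_smult, rule dvd_refl)
  have "poly p a = 0" by (simp add: p)
  moreover have "((\<lambda>x. poly p x * h k x) has_real_derivative
      (poly (pderiv p) x * h k x + poly p x * h (Suc k) x)) (at x)" for x
    by (auto intro!: derivative_eq_intros h simp: mult_ac)
  ultimately show ?case
    using vanishes_to_order_add[OF Suc.IH[OF dvd2, of k] Suc.IH[OF dvd1, of "Suc k"]]
    unfolding vanishes_to_order.simps by (intro conjI exI allI) simp_all
qed simp

lemma higher_deriv_exp_minus_poly:
  "(deriv ^^ j) (\<lambda>x. exp x - poly q x) = (\<lambda>x :: real. exp x - poly ((pderiv ^^ j) q) x)"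
proof (induction j arbitrary: q)
  case (Suc j)
  have "deriv (\<lambda>x. exp x - poly q x) = (\<lambda>x. exp x - poly (pderiv q) x)"
    by (rule ext, rule DERIV_imp_deriv) (auto intro!: derivative_eq_intros)
  then show ?case using Suc.IH[of "pderiv q"] by (simp add: funpow_swap1)
qed simp

lemma higher_deriv_exp: "(deriv ^^ j) exp = (exp :: real \<Rightarrow> real)"
  using higher_deriv_exp_minus_poly[of j 0] by (simp add: higher_pderiv_diff)

text \<open>Differentiation under the integral sign brings down one more factor \<open>1 - s / t\<close>, so the remainder
  integrals form a chain of successive derivatives, of the kind that \<open>vanishes_to_order_poly_mult\<close> takes.\<close>

lemma parametric_moment_deriv:
  fixes g :: "real \<Rightarrow> real"
  assumes g: "continuous_on {0..t} g"
  shows "((\<lambda>x. integral {0..t} (\<lambda>s. (1 - s / t) ^ k * exp (x * (1 - s / t)) * g s)) has_real_derivative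
     integral {0..t} (\<lambda>s. (1 - s / t) ^ Suc k * exp (x * (1 - s / t)) * g s)) (at x)"
proof -
  have g': "continuous_on (UNIV \<times> {0..t}) (\<lambda>(x, s). g s)"
    unfolding split_def
    by (rule continuous_on_compose2[OF g continuous_on_snd[OF continuous_on_id]]) auto
  have "((\<lambda>x. integral (cbox 0 t) (\<lambda>s. (1 - s / t) ^ k * exp (x * (1 - s / t)) * g s)) has_field_derivative
     integral (cbox 0 t) (\<lambda>s. (1 - s / t) ^ Suc k * exp (x * (1 - s / t)) * g s)) (at x within UNIV)"
  proof (rule leibniz_rule_field_derivative)
    fix x s :: real
    show "((\<lambda>x. (1 - s / t) ^ k * exp (x * (1 - s / t)) * g s) has_field_derivative
            (1 - s / t) ^ Suc k * exp (x * (1 - s / t)) * g s) (at x within UNIV)"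
      by (auto intro!: derivative_eq_intros simp: mult_ac)
    show "(\<lambda>s. (1 - s / t) ^ k * exp (x * (1 - s / t)) * g s) integrable_on cbox 0 t"
      unfolding divide_inverse by (intro integrable_continuous continuous_intros) (use g in simp)
  next
    show "continuous_on (UNIV \<times> cbox 0 t)
        (\<lambda>(x, s). (1 - s / t) ^ Suc k * exp (x * (1 - s / t)) * g s)"
      using g' unfolding split_def divide_inverse by (auto intro!: continuous_intros)
  qed auto
  then show ?thesis by simp
qed

text \<open>The substitution \<open>x \<mapsto> x / t\<close> turns interpolation of \<open>x \<mapsto> exp (x * t)\<close> at the nodes \<open>b i\<close> into interpolation of
  the exponential itself at \<open>b i * t\<close>; it produces the powers of \<open>t\<close> in the Newton coefficients.\<close>

definition newton_exp_poly :: "(nat \<Rightarrow> real) \<Rightarrow> nat \<Rightarrow> real \<Rightarrow> real poly" where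
  "newton_exp_poly b m t =
     (\<Sum>k\<le>m. smult (iterated_exp_convolution b k t / t ^ k) (\<Prod>i<k. [:- (b i * t), 1:]))"

lemma degree_newton_product:
  fixes a :: "nat \<Rightarrow> real"
  shows "degree (\<Prod>i<k. [:- a i, 1:]) = k"
  by (simp add: degree_prod_eq_sum_degree)

lemma coeff_newton_product:
  fixes a :: "nat \<Rightarrow> real"
  shows "coeff (\<Prod>i<k. [:- a i, 1:]) k = 1"
  using lead_coeff_prod[of "\<lambda>i. [:- a i, 1:]" "{..<k}"] by (simp add: degree_newton_product)

lemma degree_newton_exp_poly: "degree (newton_exp_poly b m t) \<le> m"
  unfolding newton_exp_poly_def
  by (intro degree_sum_le finite_atMost order.trans[OF degree_smult_le])
     (simp add: degree_newton_product)

lemma coeff_newton_exp_poly: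
  "coeff (newton_exp_poly b m t) m = iterated_exp_convolution b m t / t ^ m"
proof -
  have "coeff (newton_exp_poly b m t) m =
      (\<Sum>k\<le>m. iterated_exp_convolution b k t / t ^ k * coeff (\<Prod>i<k. [:- (b i * t), 1:]) m)"
    by (simp add: newton_exp_poly_def coeff_sum)
  also have "\<dots> = (\<Sum>k\<in>{m}. iterated_exp_convolution b k t / t ^ k * coeff (\<Prod>i<k. [:- (b i * t), 1:]) m)"
    by (rule sum.mono_neutral_right) (auto simp: coeff_eq_0 degree_newton_product)
  finally show ?thesis by (simp add: coeff_newton_product)
qed

lemma exp_minus_newton_exp_poly:
  assumes "t > 0"
  shows "exp x - poly (newton_exp_poly b m t) x =
     poly (smult (1 / t ^ Suc m) (\<Prod>i\<le>m. [:- (b i * t), 1:])) x *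
     integral {0..t} (\<lambda>s. exp (x * (1 - s / t)) * iterated_exp_convolution b m s)"
proof -
  let ?g = "iterated_exp_convolution b"
  have scale: "(\<Prod>i\<in>A. x / t - b i) = (\<Prod>i\<in>A. x - b i * t) / t ^ card A" for A
  proof -
    have "(\<Prod>i\<in>A. x / t - b i) = (\<Prod>i\<in>A. (x - b i * t) / t)"
      using assms by (intro prod.cong) (auto simp: field_simps)
    then show ?thesis by (simp add: prod_dividef)
  qed
  have poly: "poly (newton_exp_poly b m t) x = (\<Sum>k\<le>m. ?g k t * (\<Prod>i<k. x / t - b i))"
    by (simp add: newton_exp_poly_def poly_sum poly_prod scale)
  have cont: "continuous_on {0..t} (\<lambda>s. exp (- (x / t) * s) * ?g m s)"
    by (intro continuous_at_imp_continuous_on ballI continuous_intros iterated_exp_convolution_isCont)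
  have "(LBINT s=0..t. exp (- (x / t) * s) * ?g m s) = integral {0..t} (\<lambda>s. exp (- (x / t) * s) * ?g m s)"
    using assms interval_integral_eq_integral[OF _ borel_integrable_atLeastAtMost'[OF cont]]
    by (simp add: zero_ereal_def)
  then have "exp x * (LBINT s=0..t. exp (- (x / t) * s) * ?g m s)
      = integral {0..t} (\<lambda>s. exp x * (exp (- (x / t) * s) * ?g m s))"
    by simp
  also have "\<dots> = integral {0..t} (\<lambda>s. exp (x * (1 - s / t)) * ?g m s)"
    by (simp add: mult.assoc[symmetric] exp_add[symmetric] right_diff_distrib)
  finally have I: "exp x * (LBINT s=0..t. exp (- (x / t) * s) * ?g m s) = \<dots>" .
  show ?thesis
    using newton_exp_remainder[of "x / t" t b m] assms unfolding I[symmetric] poly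
    by (simp add: poly_prod scale)
qed

text \<open>The remainder is the product of the node polynomial and a smooth integral; a node of
  multiplicity \<open>\<mu>\<close> contributes \<open>\<mu>\<close> factors to the former, so the remainder vanishes there to order \<open>\<mu>\<close>.\<close>

lemma newton_exp_poly_interpolates:
  assumes "t > 0"
  shows "hermite_interpolates exp (\<lambda>k. b k * t) m (newton_exp_poly b m t)"
  unfolding hermite_interpolates_def
proof (intro allI impI)
  fix i j
  define \<mu> where "\<mu> = card {k. k \<le> m \<and> b k * t = b i * t}"
  assume "i \<le> m" and j: "j < card {k. k \<le> m \<and> b k * t = b i * t}"
  define \<omega> where "\<omega> = smult (1 / t ^ Suc m) (\<Prod>i\<le>m. [:- (b i * t), 1:])"
  define h where "h k x =
    integral {0..t} (\<lambda>s. (1 - s / t) ^ k * exp (x * (1 - s / t)) * iterated_exp_convolution b m s)" for k x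
  have "(\<Prod>k\<in>{k. k \<le> m \<and> b k * t = b i * t}. [:- (b k * t), 1:]) dvd (\<Prod>k\<le>m. [:- (b k * t), 1:])"
    by (rule prod_dvd_prod_subset) auto
  moreover have "(\<Prod>k\<in>{k. k \<le> m \<and> b k * t = b i * t}. [:- (b k * t), 1:]) = [:- (b i * t), 1:] ^ \<mu>"
    unfolding \<mu>_def prod_constant[symmetric] by (rule prod.cong) auto
  ultimately have "[:- (b i * t), 1:] ^ \<mu> dvd \<omega>"
    unfolding \<omega>_def by (metis dvd_smult)
  moreover have "(h k has_real_derivative h (Suc k) x) (at x)" for k x
    unfolding h_def
    by (intro parametric_moment_deriv continuous_at_imp_continuous_on ballI iterated_exp_convolution_isCont)
  ultimately have "vanishes_to_order \<mu> (b i * t) (\<lambda>x. poly \<omega> x * h 0 x)"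
    by (intro vanishes_to_order_poly_mult)
  also have "(\<lambda>x. poly \<omega> x * h 0 x) = (\<lambda>x. exp x - poly (newton_exp_poly b m t) x)"
    unfolding exp_minus_newton_exp_poly[OF assms] by (simp add: \<omega>_def h_def)
  finally have "(deriv ^^ j) (\<lambda>x. exp x - poly (newton_exp_poly b m t) x) (b i * t) = 0"
    using j by (intro vanishes_to_order_imp_higher_deriv_0) (auto simp: \<mu>_def)
  then show "poly ((pderiv ^^ j) (newton_exp_poly b m t)) (b i * t) = (deriv ^^ j) exp (b i * t)"
    by (simp add: higher_deriv_exp_minus_poly higher_deriv_exp)
qed

text \<open>A form of the Hermite--Genocchi formula for the exponential.  The Newton basis polynomials are
  monic of increasing degree, so the last Newton coefficient is the leading one.\<close>

theorem divided_difference_exp: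
  assumes "t > 0"
  shows "divided_difference exp (\<lambda>k. b k * t) m = iterated_exp_convolution b m t / t ^ m"
proof -
  have "(THE p. degree p \<le> m \<and> hermite_interpolates exp (\<lambda>k. b k * t) m p) = newton_exp_poly b m t"
    using degree_newton_exp_poly newton_exp_poly_interpolates[OF assms] hermite_interpolation_unique
    by (intro the_equality) auto
  then show ?thesis by (simp add: divided_difference_def coeff_newton_exp_poly)
qed

section \<open>Tail integrals, joint measurability and the exponential moment of a normal variable\<close>

text \<open>Rounding \<open>t\<close> down to multiples of \<open>1 / (n + 1)\<close> gives processes that take only countably many
  random variables as values; by continuity in \<open>t\<close> they converge to the process.  Joint measurability
  is what Tonelli's theorem requires later.\<close>

lemma borel_measurable_pair_continuous_paths:
  fixes X :: "real \<Rightarrow> 'a \<Rightarrow> real"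
  assumes X: "\<And>t. X t \<in> borel_measurable M"
    and cont: "\<And>\<omega> t. \<omega> \<in> space M \<Longrightarrow> isCont (\<lambda>t. X t \<omega>) t"
  shows "(\<lambda>(t, \<omega>). X t \<omega>) \<in> borel_measurable (lborel \<Otimes>\<^sub>M M)"
proof (rule borel_measurable_LIMSEQ_real)
  fix n :: nat
  have "(\<lambda>z :: real \<times> 'a. X (of_int \<lfloor>fst z * real (Suc n)\<rfloor> / real (Suc n)) (snd z))
      \<in> borel_measurable (lborel \<Otimes>\<^sub>M M)"
    by (rule measurable_compose_countable[where f = "\<lambda>i z. X (of_int i / real (Suc n)) (snd z)"])
       (use X in measurable)
  then show "(\<lambda>(t, \<omega>). X (of_int \<lfloor>t * real (Suc n)\<rfloor> / real (Suc n)) \<omega>)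
      \<in> borel_measurable (lborel \<Otimes>\<^sub>M M)"
    by (simp add: split_def)
next
  fix z :: "real \<times> 'a"
  assume z: "z \<in> space (lborel \<Otimes>\<^sub>M M)"
  obtain t \<omega> where [simp]: "z = (t, \<omega>)" by (cases z)
  have "(\<lambda>n. of_int \<lfloor>t * real (Suc n)\<rfloor> / real (Suc n)) \<longlonglongrightarrow> t"
  proof (rule tendsto_sandwich)
    show "\<forall>\<^sub>F n in sequentially. t - 1 / real (Suc n) \<le> of_int \<lfloor>t * real (Suc n)\<rfloor> / real (Suc n)"
    proof (rule always_eventually, rule allI)
      fix n
      have "t * real (Suc n) - 1 \<le> of_int \<lfloor>t * real (Suc n)\<rfloor>" by linarith
      then have "(t * real (Suc n) - 1) / real (Suc n) \<le> of_int \<lfloor>t * real (Suc n)\<rfloor> / real (Suc n)"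
        by (rule divide_right_mono) simp
      then show "t - 1 / real (Suc n) \<le> of_int \<lfloor>t * real (Suc n)\<rfloor> / real (Suc n)"
        by (simp add: diff_divide_distrib del: of_nat_Suc)
    qed
    show "\<forall>\<^sub>F n in sequentially. of_int \<lfloor>t * real (Suc n)\<rfloor> / real (Suc n) \<le> t"
      by (rule always_eventually) (simp add: pos_divide_le_eq del: of_nat_Suc)
    show "(\<lambda>n. t - 1 / real (Suc n)) \<longlonglongrightarrow> t"
      using tendsto_diff[OF tendsto_const LIMSEQ_inverse_real_of_nat, of t]
      by (simp add: inverse_eq_divide)
  qed auto
  then show "(\<lambda>n. case z of (t, \<omega>) \<Rightarrow> X (of_int \<lfloor>t * real (Suc n)\<rfloor> / real (Suc n)) \<omega>)
      \<longlonglongrightarrow> (case z of (t, \<omega>) \<Rightarrow> X t \<omega>)"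
    using z cont[of \<omega> t] by (auto intro: isCont_tendsto_compose simp: space_pair_measure)
qed

text \<open>Integrating the derivative of \<open>- (\<integral>\<^sub>s\<^sup>T f)\<^bsup>n+1\<^esup>\<close> over \<open>[a, T]\<close>.  Among the \<open>n + 1\<close> integration
  variables of the power, this singles out the smallest one as \<open>s\<close>.\<close>

lemma power_tail_integral:
  fixes f :: "real \<Rightarrow> real"
  assumes cont: "\<And>x. isCont f x" and nonneg: "\<And>x. 0 \<le> f x" and "a \<le> T"
  shows "ennreal ((LBINT u:{a..T}. f u) ^ Suc n) =
    (\<integral>\<^sup>+s. ennreal (real (Suc n) * f s * (LBINT u:{s..T}. f u) ^ n) * indicator {a..T} s \<partial>lborel)"
proof -
  define P where "P u = (LBINT y=0..u. f y)" for u :: real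
  have P: "(P has_real_derivative f x) (at x)" for x
    unfolding P_def by (rule interval_integral_has_real_derivative) (rule cont)
  have f_borel: "f \<in> borel_measurable borel"
    by (intro borel_measurable_continuous_onI continuous_at_imp_continuous_on ballI cont)
  have P_borel: "P \<in> borel_measurable borel"
    by (intro borel_measurable_continuous_onI continuous_at_imp_continuous_on ballI DERIV_isCont[OF P])
  have tail: "(LBINT u:{s..T}. f u) = P T - P s" if "s \<le> T" for s
    using integral_FTC_Icc_nonneg[OF f_borel P nonneg that]
    by (simp add: set_lebesgue_integral_def mult.commute)
  have mono: "P s \<le> P T" if "s \<le> T" for s
    using DERIV_nonneg_imp_nondecreasing[OF that] P nonneg by blast
  have "(\<integral>\<^sup>+s. ennreal (real (Suc n) * f s * (LBINT u:{s..T}. f u) ^ n) * indicator {a..T} s \<partial>lborel)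
      = (\<integral>\<^sup>+s. ennreal (real (Suc n) * f s * (P T - P s) ^ n) * indicator {a..T} s \<partial>lborel)"
    by (intro nn_integral_cong) (auto split: split_indicator simp: tail)
  also have "\<dots> = ennreal (- ((P T - P T) ^ Suc n) - - ((P T - P a) ^ Suc n))"
  proof (rule nn_integral_FTC_Icc)
    show "(\<lambda>s. real (Suc n) * f s * (P T - P s) ^ n) \<in> borel_measurable borel"
      using f_borel P_borel by measurable
    show "DERIV (\<lambda>s. - ((P T - P s) ^ Suc n)) s :> real (Suc n) * f s * (P T - P s) ^ n" for s
      by (rule derivative_eq_intros P refl | simp add: mult_ac)+
    show "0 \<le> real (Suc n) * f s * (P T - P s) ^ n" if "s \<in> {a..T}" for s
      using that mono[of s] nonneg[of s] by simp
  qed fact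
  finally show ?thesis using \<open>a \<le> T\<close> by (simp add: tail)
qed

text \<open>The convolution recursion with the time axis reversed: by the linear system,
  \<open>- exp (b (n + 1) * (s - a)) * g\<^bsub>n+1\<^esub> (T - s)\<close> is an antiderivative of the integrand.\<close>

lemma nn_integral_iterated_exp_convolution:
  assumes "a \<le> T"
  shows "(\<integral>\<^sup>+s. ennreal (exp (b (Suc n) * (s - a)) * iterated_exp_convolution b n (T - s)) * indicator {a..T} s \<partial>lborel)
    = ennreal (iterated_exp_convolution b (Suc n) (T - a))"
proof -
  let ?g = "iterated_exp_convolution b"
  have "(\<integral>\<^sup>+s. ennreal (exp (b (Suc n) * (s - a)) * ?g n (T - s)) * indicator {a..T} s \<partial>lborel)
    = ennreal (- (exp (b (Suc n) * (T - a)) * ?g (Suc n) (T - T)) - - (exp (b (Suc n) * (a - a)) * ?g (Suc n) (T - a)))"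
  proof (rule nn_integral_FTC_Icc)
    have "isCont (\<lambda>s. ?g n (T - s)) s" for s
      by (rule isCont_o2[OF _ iterated_exp_convolution_isCont]) (intro continuous_intros)
    then show "(\<lambda>s. exp (b (Suc n) * (s - a)) * ?g n (T - s)) \<in> borel_measurable borel"
      by (intro borel_measurable_continuous_onI continuous_at_imp_continuous_on ballI continuous_intros)
    fix s
    have "((\<lambda>s. ?g (Suc n) (T - s)) has_real_derivative
        (b (Suc n) * ?g (Suc n) (T - s) + ?g n (T - s)) * (- 1)) (at s)"
      by (rule DERIV_chain2[OF iterated_exp_convolution_deriv_Suc]) (auto intro!: derivative_eq_intros)
    then show "DERIV (\<lambda>s. - (exp (b (Suc n) * (s - a)) * ?g (Suc n) (T - s))) s :>
        exp (b (Suc n) * (s - a)) * ?g n (T - s)"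
      by - (rule DERIV_cong, (rule derivative_intros | assumption)+, simp add: algebra_simps)
    show "0 \<le> exp (b (Suc n) * (s - a)) * ?g n (T - s)" if "s \<in> {a..T}"
      using that by (intro mult_nonneg_nonneg iterated_exp_convolution_nonneg) auto
  qed fact
  then show ?thesis by simp
qed

text \<open>Completing the square: tilting a centred normal density by \<open>exp (c * x)\<close> yields a
  multiple of the normal density with mean \<open>c * s\<^sup>2\<close>.\<close>

lemma nn_integral_exp_normal:
  assumes "distributed M lborel Z (normal_density 0 s)" "s > 0"
  shows "(\<integral>\<^sup>+\<omega>. ennreal (exp (c * Z \<omega>)) \<partial>M) = ennreal (exp (c\<^sup>2 * s\<^sup>2 / 2))"
proof -
  have shift: "normal_density 0 s x * exp (c * x) = exp (c\<^sup>2 * s\<^sup>2 / 2) * normal_density (c * s\<^sup>2) s x" for x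
  proof -
    have "- (x - 0)\<^sup>2 / (2 * s\<^sup>2) + c * x = c\<^sup>2 * s\<^sup>2 / 2 + - (x - c * s\<^sup>2)\<^sup>2 / (2 * s\<^sup>2)"
      using \<open>s > 0\<close> by (simp add: field_simps power2_eq_square)
    then have "exp (- (x - 0)\<^sup>2 / (2 * s\<^sup>2)) * exp (c * x)
        = exp (c\<^sup>2 * s\<^sup>2 / 2) * exp (- (x - c * s\<^sup>2)\<^sup>2 / (2 * s\<^sup>2))"
      by (simp only: exp_add[symmetric])
    then show ?thesis by (simp add: normal_density_def mult_ac)
  qed
  have "(\<integral>\<^sup>+\<omega>. ennreal (exp (c * Z \<omega>)) \<partial>M)
      = (\<integral>\<^sup>+x. ennreal (normal_density 0 s x) * ennreal (exp (c * x)) \<partial>lborel)"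
    by (rule distributed_nn_integral[OF assms(1), symmetric]) measurable
  also have "\<dots> = (\<integral>\<^sup>+x. ennreal (exp (c\<^sup>2 * s\<^sup>2 / 2)) * ennreal (normal_density (c * s\<^sup>2) s x) \<partial>lborel)"
    by (simp add: ennreal_mult'[symmetric] shift)
  also have "\<dots> = ennreal (exp (c\<^sup>2 * s\<^sup>2 / 2)) * (\<integral>\<^sup>+x. ennreal (normal_density (c * s\<^sup>2) s x) \<partial>lborel)"
    by (rule nn_integral_cmult) measurable
  also have "(\<integral>\<^sup>+x. ennreal (normal_density (c * s\<^sup>2) s x) \<partial>lborel) = 1"
    using prob_space.emeasure_space_1[OF prob_space_normal_density[OF \<open>s > 0\<close>, of "c * s\<^sup>2"]]
    by (simp add: emeasure_density)
  finally show ?thesis by simp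
qed

section \<open>Moments of the integrated price\<close>

context standard_brownian_motion
begin

text \<open>Freezing the process at time \<open>0\<close> for negative times gives paths that are continuous on
  the whole real line, so that derivatives of path integrals need no one-sided versions.\<close>

definition price :: "real \<Rightarrow> real \<Rightarrow> real \<Rightarrow> 'a \<Rightarrow> real" where
  "price r \<sigma> t = stock_price r \<sigma> B (max 0 t)"

definition tail_integral :: "real \<Rightarrow> real \<Rightarrow> real \<Rightarrow> real \<Rightarrow> 'a \<Rightarrow> real" where
  "tail_integral r \<sigma> T s \<omega> = (LBINT u:{s..T}. price r \<sigma> u \<omega>)"

lemma price_pos: "price r \<sigma> t \<omega> > 0"
  by (simp add: price_def stock_price_def)

lemma isCont_price:
  assumes "\<omega> \<in> space M"
  shows "isCont (\<lambda>t. price r \<sigma> t \<omega>) t"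
proof -
  have "continuous_on UNIV (\<lambda>t. B (max 0 t) \<omega>)"
    by (rule continuous_on_compose2[OF continuous_paths[OF assms]]) (auto intro!: continuous_intros)
  then have "isCont (\<lambda>t. B (max 0 t) \<omega>) t" by (simp add: continuous_on_eq_continuous_at)
  then show ?thesis unfolding price_def stock_price_def by (intro continuous_intros)
qed

lemma price_measurable_pair:
  "(\<lambda>(t, \<omega>). price r \<sigma> t \<omega>) \<in> borel_measurable (lborel \<Otimes>\<^sub>M M)"
proof (rule borel_measurable_pair_continuous_paths)
  fix t
  have [measurable]: "B (max 0 t) \<in> borel_measurable M" by (rule random_variable_B) simp
  show "price r \<sigma> t \<in> borel_measurable M"
    unfolding price_def stock_price_def by measurable
qed (rule isCont_price)

lemma price_measurable [measurable (raw)]: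
  assumes "f \<in> borel_measurable N" "g \<in> measurable N M"
  shows "(\<lambda>x. price r \<sigma> (f x) (g x)) \<in> borel_measurable N"
  using measurable_compose[OF measurable_Pair[of f N lborel g M] price_measurable_pair] assms
  by simp

lemma tail_integral_measurable_pair:
  "(\<lambda>(s, \<omega>). tail_integral r \<sigma> T s \<omega>) \<in> borel_measurable (lborel \<Otimes>\<^sub>M M)"
proof -
  have "(\<lambda>(s, \<omega>). LINT u|lborel. (if s \<le> u \<and> u \<le> T then 1 else 0) * price r \<sigma> u \<omega>)
      \<in> borel_measurable (lborel \<Otimes>\<^sub>M M)"
    by measurable
  also have "(\<lambda>(s, \<omega>). LINT u|lborel. (if s \<le> u \<and> u \<le> T then 1 else 0) * price r \<sigma> u \<omega>)
      = (\<lambda>(s, \<omega>). tail_integral r \<sigma> T s \<omega>)"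
    unfolding tail_integral_def set_lebesgue_integral_def
    by (auto simp: fun_eq_iff split: split_indicator intro!: Bochner_Integration.integral_cong)
  finally show ?thesis .
qed

lemma tail_integral_measurable [measurable (raw)]:
  assumes "f \<in> borel_measurable N" "g \<in> measurable N M"
  shows "(\<lambda>x. tail_integral r \<sigma> T (f x) (g x)) \<in> borel_measurable N"
  using measurable_compose[OF measurable_Pair[of f N lborel g M] tail_integral_measurable_pair] assms
  by simp

lemma tail_integral_nonneg: "tail_integral r \<sigma> T s \<omega> \<ge> 0"
  unfolding tail_integral_def set_lebesgue_integral_def
  by (rule Bochner_Integration.integral_nonneg) (auto simp: price_pos less_imp_le)

lemma price_ratio_power:
  assumes "0 \<le> u" "u \<le> v"
  shows "(price r \<sigma> v \<omega> / price r \<sigma> u \<omega>) ^ k =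
    exp (real k * (r - \<sigma>\<^sup>2 / 2) * (v - u) + (real k * \<sigma>) * (B v \<omega> - B u \<omega>))"
  using assms
  by (simp add: price_def stock_price_def exp_diff[symmetric] exp_of_nat_mult[symmetric] field_simps)

lemma nn_integral_price_ratio_power:
  assumes "0 \<le> u" "u < v"
  shows "(\<integral>\<^sup>+\<omega>. ennreal ((price r \<sigma> v \<omega> / price r \<sigma> u \<omega>) ^ k) \<partial>M) = ennreal (exp (moment_rate r \<sigma> k * (v - u)))"
proof -
  have [measurable]: "B u \<in> borel_measurable M" "B v \<in> borel_measurable M"
    using assms by (auto intro: random_variable_B)
  have "(\<integral>\<^sup>+\<omega>. ennreal ((price r \<sigma> v \<omega> / price r \<sigma> u \<omega>) ^ k) \<partial>M)
      = (\<integral>\<^sup>+\<omega>. ennreal (exp (real k * (r - \<sigma>\<^sup>2 / 2) * (v - u))) *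
                ennreal (exp ((real k * \<sigma>) * (B v \<omega> - B u \<omega>))) \<partial>M)"
    using assms by (simp only: price_ratio_power less_imp_le exp_add) (simp add: ennreal_mult')
  also have "\<dots> = ennreal (exp (real k * (r - \<sigma>\<^sup>2 / 2) * (v - u))) *
      (\<integral>\<^sup>+\<omega>. ennreal (exp ((real k * \<sigma>) * (B v \<omega> - B u \<omega>))) \<partial>M)"
    by (rule nn_integral_cmult) measurable
  also have "(\<integral>\<^sup>+\<omega>. ennreal (exp ((real k * \<sigma>) * (B v \<omega> - B u \<omega>))) \<partial>M)
      = ennreal (exp ((real k * \<sigma>)\<^sup>2 * (sqrt (v - u))\<^sup>2 / 2))"
    using assms by (intro nn_integral_exp_normal normal_increments) auto
  also have "ennreal (exp (real k * (r - \<sigma>\<^sup>2 / 2) * (v - u))) * \<dots>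
      = ennreal (exp (real k * (r - \<sigma>\<^sup>2 / 2) * (v - u) + (real k * \<sigma>)\<^sup>2 * (v - u) / 2))"
    using assms by (simp add: ennreal_mult'[symmetric] exp_add[symmetric])
  also have "real k * (r - \<sigma>\<^sup>2 / 2) * (v - u) + (real k * \<sigma>)\<^sup>2 * (v - u) / 2 = moment_rate r \<sigma> k * (v - u)"
    by (simp add: moment_rate_def field_simps power2_eq_square)
  finally show ?thesis .
qed

text \<open>The price ratio over an interval is a function of the Brownian increment over it alone, so
  ratios over successive intervals are independent.\<close>

lemma nn_integral_prod_price_ratio_power:
  fixes t :: "nat \<Rightarrow> real"
  assumes "0 \<le> t 0" and incr: "\<And>i. i < n \<Longrightarrow> t i < t (Suc i)"
  shows "(\<integral>\<^sup>+\<omega>. ennreal (\<Prod>i<n. (price r \<sigma> (t (Suc i)) \<omega> / price r \<sigma> (t i) \<omega>) ^ k i) \<partial>M)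
    = ennreal (\<Prod>i<n. exp (moment_rate r \<sigma> (k i) * (t (Suc i) - t i)))"
proof -
  have nonneg: "0 \<le> t i" if "i \<le> n" for i
    using that
  proof (induction i)
    case (Suc i)
    then show ?case using incr[of i] by simp
  qed (use assms in simp)
  have "indep_vars (\<lambda>_. borel) (\<lambda>i \<omega>. B (t (Suc i)) \<omega> - B (t i) \<omega>) {..<n}"
    using assms by (rule indep_increments)
  then have "indep_vars (\<lambda>_. borel) (\<lambda>i \<omega>. ennreal (exp (real (k i) * (r - \<sigma>\<^sup>2 / 2) * (t (Suc i) - t i)
      + (real (k i) * \<sigma>) * (B (t (Suc i)) \<omega> - B (t i) \<omega>)))) {..<n}"
    by (rule indep_vars_compose2) measurable
  then have indep: "indep_vars (\<lambda>_. borel)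
      (\<lambda>i \<omega>. ennreal ((price r \<sigma> (t (Suc i)) \<omega> / price r \<sigma> (t i) \<omega>) ^ k i)) {..<n}"
    using incr nonneg
    by (subst indep_vars_cong[OF refl _ refl]) (auto simp: price_ratio_power less_imp_le)
  have "(\<integral>\<^sup>+\<omega>. ennreal (\<Prod>i<n. (price r \<sigma> (t (Suc i)) \<omega> / price r \<sigma> (t i) \<omega>) ^ k i) \<partial>M)
      = (\<integral>\<^sup>+\<omega>. (\<Prod>i<n. ennreal ((price r \<sigma> (t (Suc i)) \<omega> / price r \<sigma> (t i) \<omega>) ^ k i)) \<partial>M)"
    by (subst prod_ennreal) (auto simp: price_pos less_imp_le)
  also have "\<dots> = (\<Prod>i<n. \<integral>\<^sup>+\<omega>. ennreal ((price r \<sigma> (t (Suc i)) \<omega> / price r \<sigma> (t i) \<omega>) ^ k i) \<partial>M)"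
    by (rule indep_vars_nn_integral) (use indep in auto)
  also have "\<dots> = (\<Prod>i<n. ennreal (exp (moment_rate r \<sigma> (k i) * (t (Suc i) - t i))))"
    using incr nonneg by (intro prod.cong nn_integral_price_ratio_power) auto
  finally show ?thesis by (simp add: prod_ennreal)
qed

text \<open>This is the inductive core.  A power of the normalised tail integral is peeled off one factor
  at a time: with \<open>s\<close> the smallest of the \<open>n + 1\<close> integration times, that power becomes an integral over \<open>s\<close> of
  \<open>(n + 1) * (S s / S a) ^ (n + 1) * (F s / S s) ^ n\<close>, where \<open>a = t j\<close>, \<open>S\<close> is the price and \<open>F\<close> the tail
  integral.  After Tonelli, the new ratio joins the product as another increment and
  \<open>n\<close> has dropped by one.  The statement carries arbitrarily many earlier ratios along in order to reduce all probability
  to the independence of finitely many increments, which enters at \<open>n = 0\<close>.\<close>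

lemma nn_integral_price_ratios_tail_integral_power:
  fixes t :: "nat \<Rightarrow> real"
  assumes "0 \<le> t 0" and "\<And>i. i < j \<Longrightarrow> t i < t (Suc i)" and "t j \<le> T"
  shows "(\<integral>\<^sup>+\<omega>. ennreal ((\<Prod>i<j. (price r \<sigma> (t (Suc i)) \<omega> / price r \<sigma> (t i) \<omega>) ^ k i)
              * (tail_integral r \<sigma> T (t j) \<omega> / price r \<sigma> (t j) \<omega>) ^ n) \<partial>M)
    = ennreal ((\<Prod>i<j. exp (moment_rate r \<sigma> (k i) * (t (Suc i) - t i)))
              * (fact n * iterated_exp_convolution (moment_rate r \<sigma>) n (T - t j)))"
  using assms
proof (induction n arbitrary: t k j)
  case 0
  then show ?case
    using nn_integral_prod_price_ratio_power[of t j r \<sigma> k]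
    by (simp add: iterated_exp_convolution.simps moment_rate_def)
next
  case (Suc n)
  let ?b = "moment_rate r \<sigma>" and ?g = "iterated_exp_convolution (moment_rate r \<sigma>)"
  let ?S = "price r \<sigma>" and ?F = "tail_integral r \<sigma> T"
  define a where "a = t j"
  define W where "W \<omega> = (\<Prod>i<j. (?S (t (Suc i)) \<omega> / ?S (t i) \<omega>) ^ k i)" for \<omega>
  define C where "C = (\<Prod>i<j. exp (?b (k i) * (t (Suc i) - t i)))"
  have W_nonneg: "0 \<le> W \<omega>" for \<omega>
    unfolding W_def by (intro prod_nonneg) (auto simp: price_pos less_imp_le)
  have C_nonneg: "0 \<le> C" unfolding C_def by (intro prod_nonneg) auto
  have [measurable]: "W \<in> borel_measurable M" unfolding W_def by measurable
  define Q where "Q s \<omega> = W \<omega> * (?S s \<omega> / ?S a \<omega>) ^ Suc n * (?F s \<omega> / ?S s \<omega>) ^ n" for s \<omega>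
  have Q_measurable [measurable]: "(\<lambda>x. Q (f x) (g x)) \<in> borel_measurable N"
    if "f \<in> borel_measurable N" "g \<in> measurable N M" for f g and N :: "'b measure"
    using that unfolding Q_def by measurable
  \<comment> \<open>the smallest integration time, isolated along each path\<close>
  have path: "ennreal (W \<omega> * (?F a \<omega> / ?S a \<omega>) ^ Suc n)
      = (\<integral>\<^sup>+s. ennreal (real (Suc n)) * ennreal (Q s \<omega>) * indicator {a..T} s \<partial>lborel)"
    if \<omega>: "\<omega> \<in> space M" for \<omega>
  proof -
    have [measurable]: "(\<lambda>s. ?S s \<omega>) \<in> borel_measurable lborel" "(\<lambda>s. ?F s \<omega>) \<in> borel_measurable lborel"
      using \<omega> by measurable
    have "ennreal (W \<omega> * (?F a \<omega> / ?S a \<omega>) ^ Suc n) = ennreal (W \<omega> / ?S a \<omega> ^ Suc n) * ennreal (?F a \<omega> ^ Suc n)"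
      using W_nonneg by (subst ennreal_mult[symmetric])
        (auto simp: tail_integral_nonneg price_pos less_imp_le power_divide)
    also have "ennreal (?F a \<omega> ^ Suc n)
        = (\<integral>\<^sup>+s. ennreal (real (Suc n) * ?S s \<omega> * ?F s \<omega> ^ n) * indicator {a..T} s \<partial>lborel)"
      unfolding tail_integral_def using Suc.prems(3)
      by (intro power_tail_integral isCont_price \<omega> less_imp_le[OF price_pos]) (simp add: a_def)
    also have "ennreal (W \<omega> / ?S a \<omega> ^ Suc n) * \<dots> = (\<integral>\<^sup>+s. ennreal (W \<omega> / ?S a \<omega> ^ Suc n) *
        (ennreal (real (Suc n) * ?S s \<omega> * ?F s \<omega> ^ n) * indicator {a..T} s) \<partial>lborel)"
      by (rule nn_integral_cmult[symmetric]) measurable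
    also have "\<dots> = (\<integral>\<^sup>+s. ennreal (real (Suc n)) * ennreal (Q s \<omega>) * indicator {a..T} s \<partial>lborel)"
    proof (rule nn_integral_cong)
      fix s
      have "W \<omega> / ?S a \<omega> ^ Suc n * (real (Suc n) * ?S s \<omega> * ?F s \<omega> ^ n) = real (Suc n) * Q s \<omega>"
        using price_pos[of r \<sigma> s \<omega>] price_pos[of r \<sigma> a \<omega>]
        by (simp add: Q_def field_simps power_divide)
      then have "ennreal (W \<omega> / ?S a \<omega> ^ Suc n) * ennreal (real (Suc n) * ?S s \<omega> * ?F s \<omega> ^ n)
          = ennreal (real (Suc n)) * ennreal (Q s \<omega>)"
        using W_nonneg by (metis (no_types, opaque_lifting) divide_nonneg_nonneg ennreal_mult' less_imp_le of_nat_0_le_iff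
            price_pos zero_le_power)
      then show "ennreal (W \<omega> / ?S a \<omega> ^ Suc n) * (ennreal (real (Suc n) * ?S s \<omega> * ?F s \<omega> ^ n) * indicator {a..T} s)
          = ennreal (real (Suc n)) * ennreal (Q s \<omega>) * indicator {a..T} s"
        by (simp add: mult.assoc[symmetric])
    qed
    finally show ?thesis .
  qed
  \<comment> \<open>the induction hypothesis, with that time appended to the sequence\<close>
  have step: "(\<integral>\<^sup>+\<omega>. ennreal (Q s \<omega>) \<partial>M) = ennreal (C * (exp (?b (Suc n) * (s - a)) * (fact n * ?g n (T - s))))"
    if s: "a < s" "s \<le> T" for s
  proof -
    let ?t = "t(Suc j := s)" and ?k = "k(j := Suc n)"
    have "(\<Prod>i<Suc j. (?S (?t (Suc i)) \<omega> / ?S (?t i) \<omega>) ^ ?k i) = W \<omega> * (?S s \<omega> / ?S a \<omega>) ^ Suc n" for \<omega>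
      unfolding prod.lessThan_Suc W_def a_def by (intro arg_cong2[of _ _ _ _ "(*)"] prod.cong) auto
    moreover have "(\<Prod>i<Suc j. exp (?b (?k i) * (?t (Suc i) - ?t i))) = C * exp (?b (Suc n) * (s - a))"
      unfolding prod.lessThan_Suc C_def a_def by (intro arg_cong2[of _ _ _ _ "(*)"] prod.cong) auto
    moreover have "?t i < ?t (Suc i)" if "i < Suc j" for i
      using that s Suc.prems(2)[of i] by (cases "i = j") (auto simp: a_def)
    ultimately show ?thesis
      using Suc.IH[of ?t "Suc j" ?k] s Suc.prems(1) by (simp add: Q_def mult.assoc)
  qed
  have "(\<integral>\<^sup>+\<omega>. ennreal (W \<omega> * (?F a \<omega> / ?S a \<omega>) ^ Suc n) \<partial>M)
      = (\<integral>\<^sup>+\<omega>. \<integral>\<^sup>+s. ennreal (real (Suc n)) * ennreal (Q s \<omega>) * indicator {a..T} s \<partial>lborel \<partial>M)"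
    by (intro nn_integral_cong path)
  also have "\<dots> = (\<integral>\<^sup>+s. \<integral>\<^sup>+\<omega>. ennreal (real (Suc n)) * ennreal (Q s \<omega>) * indicator {a..T} s \<partial>M \<partial>lborel)"
  proof (rule pair_sigma_finite.Fubini')
    show "pair_sigma_finite lborel M"
      by (intro pair_sigma_finite.intro lborel.sigma_finite_measure_axioms sigma_finite_measure_axioms)
    show "(\<lambda>(s, \<omega>). ennreal (real (Suc n)) * ennreal (Q s \<omega>) * indicator {a..T} s) \<in> borel_measurable (lborel \<Otimes>\<^sub>M M)"
      by measurable
  qed
  also have "\<dots> = (\<integral>\<^sup>+s. ennreal (C * fact (Suc n)) *
      (ennreal (exp (?b (Suc n) * (s - a)) * ?g n (T - s)) * indicator {a..T} s) \<partial>lborel)"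
  \<comment> \<open>the sequence of times must increase strictly, so the null set where the new time equals the last one is set aside\<close>
  proof (rule nn_integral_cong_AE, rule AE_mp[OF AE_lborel_singleton[of a]], rule AE_I2, rule impI)
    fix s assume "s \<noteq> a"
    show "(\<integral>\<^sup>+\<omega>. ennreal (real (Suc n)) * ennreal (Q s \<omega>) * indicator {a..T} s \<partial>M)
      = ennreal (C * fact (Suc n)) * (ennreal (exp (?b (Suc n) * (s - a)) * ?g n (T - s)) * indicator {a..T} s)"
    proof (cases "s \<in> {a..T}")
      case True
      then have s: "a < s" "s \<le> T" using \<open>s \<noteq> a\<close> by auto
      have "(\<integral>\<^sup>+\<omega>. ennreal (real (Suc n)) * ennreal (Q s \<omega>) \<partial>M)
          = ennreal (real (Suc n)) * ennreal (C * (exp (?b (Suc n) * (s - a)) * (fact n * ?g n (T - s))))"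
        by (subst nn_integral_cmult) (simp_all only: step[OF s], measurable)
      also have "\<dots> = ennreal (C * fact (Suc n)) * ennreal (exp (?b (Suc n) * (s - a)) * ?g n (T - s))"
        using C_nonneg by (simp add: ennreal_mult'[symmetric] mult_ac del: of_nat_Suc)
      finally show ?thesis using True by simp
    qed simp
  qed
  also have "\<dots> = ennreal (C * fact (Suc n)) *
      (\<integral>\<^sup>+s. ennreal (exp (?b (Suc n) * (s - a)) * ?g n (T - s)) * indicator {a..T} s \<partial>lborel)"
  proof (rule nn_integral_cmult)
    have "?g n \<in> borel_measurable borel"
      by (intro borel_measurable_continuous_onI continuous_at_imp_continuous_on ballI iterated_exp_convolution_isCont)
    then show "(\<lambda>s. ennreal (exp (?b (Suc n) * (s - a)) * ?g n (T - s)) * indicator {a..T} s) \<in> borel_measurable lborel"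
      by measurable
  qed
  also have "\<dots> = ennreal (C * fact (Suc n)) * ennreal (?g (Suc n) (T - a))"
    using Suc.prems(3) by (subst nn_integral_iterated_exp_convolution) (simp_all add: a_def)
  also have "\<dots> = ennreal (C * (fact (Suc n) * ?g (Suc n) (T - a)))"
    using C_nonneg by (simp add: ennreal_mult'[symmetric] mult_ac)
  finally show ?case
    unfolding W_def C_def a_def .
qed

lemma expectation_price_integral_power:
  assumes "0 \<le> T"
  shows "expectation (\<lambda>\<omega>. (LBINT t:{0..T}. stock_price r \<sigma> B t \<omega>) ^ m)
    = fact m * iterated_exp_convolution (moment_rate r \<sigma>) m T"
proof -
  have "(LBINT t:{0..T}. stock_price r \<sigma> B t \<omega>) = tail_integral r \<sigma> T 0 \<omega>" for \<omega>
    unfolding tail_integral_def set_lebesgue_integral_def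
    by (intro Bochner_Integration.integral_cong) (auto simp: price_def split: split_indicator)
  then have "expectation (\<lambda>\<omega>. (LBINT t:{0..T}. stock_price r \<sigma> B t \<omega>) ^ m)
      = enn2real (\<integral>\<^sup>+\<omega>. ennreal (tail_integral r \<sigma> T 0 \<omega> ^ m) \<partial>M)"
    by (simp only:) (rule integral_eq_nn_integral, measurable, simp add: tail_integral_nonneg)
  also have "(\<integral>\<^sup>+\<omega>. ennreal (tail_integral r \<sigma> T 0 \<omega> ^ m) \<partial>M)
      = (\<integral>\<^sup>+\<omega>. ennreal ((tail_integral r \<sigma> T 0 \<omega> / price r \<sigma> 0 \<omega>) ^ m) \<partial>M)"
    by (intro nn_integral_cong) (simp add: price_def stock_price_def B_zero)
  also have "\<dots> = ennreal (fact m * iterated_exp_convolution (moment_rate r \<sigma>) m T)"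
    using nn_integral_price_ratios_tail_integral_power[of "\<lambda>_. 0" 0 T r \<sigma> "\<lambda>_. 0" m] assms by simp
  finally show ?thesis
    using iterated_exp_convolution_nonneg[OF assms] by simp
qed

end

theorem theorem3p3:
  fixes M :: "'a measure" and B :: "real \<Rightarrow> 'a \<Rightarrow> real"
    and r \<sigma> T :: real and m :: nat
  assumes "standard_brownian_motion M B"
    and "\<sigma> \<ge> 0" and "T > 0"
  shows "prob_space.expectation M (\<lambda>\<omega>. time_average (stock_price r \<sigma> B) T \<omega> ^ m)
       = fact m * divided_difference exp (\<lambda>k. moment_rate r \<sigma> k * T) m"
proof -
  interpret standard_brownian_motion M B by fact
  have "expectation (\<lambda>\<omega>. time_average (stock_price r \<sigma> B) T \<omega> ^ m)
      = expectation (\<lambda>\<omega>. (LBINT t:{0..T}. stock_price r \<sigma> B t \<omega>) ^ m / T ^ m)"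
    by (simp add: time_average_def power_divide)
  also have "\<dots> = fact m * (iterated_exp_convolution (moment_rate r \<sigma>) m T / T ^ m)"
    using \<open>T > 0\<close> by (simp add: expectation_price_integral_power)
  finally show ?thesis
    using \<open>T > 0\<close> by (simp add: divided_difference_exp)
qed

end
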